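(* Let $\mu\in\mathbb{R}^n$ and let $K\subset\mathbb{R}^n$ be a (nonempty) closed convex set. Then $\min_{u\in K}\|u-\mu\|=\|\Pi_K(\mu)-\mu\|$ and for any (possibly random) $\hat\mu\in K$, the following holds almost surely: $$\left(\|\hat\mu-\mu\|-\|\Pi_K(\mu)-\mu\|\right)^2\le\|\hat\mu-\Pi_K(\mu)\|^2\le\|\hat\mu-\mu\|^2-\|\Pi_K(\mu)-\mu\|^2.$$
   Context: Scaled norm: $\|v\|^2=\frac1n\sum_{i=1}^n v_i^2$ for $v\in\mathbb{R}^n$. $\Pi_K$ is the Euclidean projection onto $K$. *)

theory Defs
  imports "HOL-Probability.Probability"
begin

definition scaled_norm :: "real ^ 'n \<Rightarrow> real" where
  "scaled_norm v = sqrt (1 / real CARD('n) * (\<Sum>i\<in>UNIV. (v $ i)\<^sup>2))"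

end

theory Submission
  imports Defs
begin

text \<open>
  The scaled norm is a positive multiple of the Euclidean norm. The lower bound is then the reverse
  triangle inequality, and the upper bound comes from expanding
  \<open>\<mu>h - \<mu> = (\<mu>h - p) + (p - \<mu>)\<close> with \<open>p\<close> the projection: the cross term is nonnegative by the
  variational characterisation of the projection onto a convex set.
\<close>

lemma scaled_norm_eq_norm:
  fixes v :: "real ^ 'n"
  shows "scaled_norm v = norm v / sqrt (real CARD('n))"
  by (simp add: scaled_norm_def norm_vec_def L2_set_def real_sqrt_divide)

lemma norm_diff_diff_square_le:
  fixes x y z :: "'a::real_normed_vector"
  shows "(norm (x - z) - norm (y - z))\<^sup>2 \<le> (norm (x - y))\<^sup>2"
  using norm_triangle_ineq3[of "x - z" "y - z"] by (simp add: abs_le_square_iff[symmetric])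

text \<open>With \<open>p\<close> the projection of \<open>a\<close>,
  \<open>closest_point_dot\<close> gives \<open>inner (a - p) (x - p) \<le> 0\<close>; right side
  minus left side is exactly \<open>2 * inner (x - p) (p - a)\<close>.\<close>

lemma closest_point_pythagoras_le:
  fixes a x :: "'a::euclidean_space"
  assumes "convex S" "closed S" "x \<in> S"
  shows "(norm (x - closest_point S a))\<^sup>2 \<le> (norm (x - a))\<^sup>2 - (norm (closest_point S a - a))\<^sup>2"
  using closest_point_dot[OF assms, of a]
  by (simp add: power2_norm_eq_inner inner_diff inner_commute)

theorem proposition5p1:
  fixes \<mu> :: "real ^ 'n" and K :: "(real ^ 'n) set"
  assumes "closed K" and "convex K" and "K \<noteq> {}"
  shows "(closest_point K \<mu> \<in> K \<and>
           (\<forall>u\<in>K. scaled_norm (closest_point K \<mu> - \<mu>) \<le> scaled_norm (u - \<mu>))) \<and>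
         (\<forall>(M :: 'w measure) (\<mu>h :: 'w \<Rightarrow> real ^ 'n).
            prob_space M \<longrightarrow> \<mu>h \<in> borel_measurable M \<longrightarrow> (AE \<omega> in M. \<mu>h \<omega> \<in> K) \<longrightarrow>
            (AE \<omega> in M.
               (scaled_norm (\<mu>h \<omega> - \<mu>) - scaled_norm (closest_point K \<mu> - \<mu>))\<^sup>2
                 \<le> (scaled_norm (\<mu>h \<omega> - closest_point K \<mu>))\<^sup>2 \<and>
               (scaled_norm (\<mu>h \<omega> - closest_point K \<mu>))\<^sup>2
                 \<le> (scaled_norm (\<mu>h \<omega> - \<mu>))\<^sup>2 - (scaled_norm (closest_point K \<mu> - \<mu>))\<^sup>2))"
proof (intro conjI ballI allI impI)
  show "closest_point K \<mu> \<in> K"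
    using assms by (simp add: closest_point_in_set)
  show "scaled_norm (closest_point K \<mu> - \<mu>) \<le> scaled_norm (u - \<mu>)" if "u \<in> K" for u
    using closest_point_le[OF \<open>closed K\<close> that, of \<mu>]
    by (simp add: scaled_norm_eq_norm divide_right_mono dist_norm norm_minus_commute)
next
  fix M :: "'w measure" and \<mu>h :: "'w \<Rightarrow> real ^ 'n"
  assume "AE \<omega> in M. \<mu>h \<omega> \<in> K"
  then show "AE \<omega> in M.
      (scaled_norm (\<mu>h \<omega> - \<mu>) - scaled_norm (closest_point K \<mu> - \<mu>))\<^sup>2
        \<le> (scaled_norm (\<mu>h \<omega> - closest_point K \<mu>))\<^sup>2 \<and>
      (scaled_norm (\<mu>h \<omega> - closest_point K \<mu>))\<^sup>2
        \<le> (scaled_norm (\<mu>h \<omega> - \<mu>))\<^sup>2 - (scaled_norm (closest_point K \<mu> - \<mu>))\<^sup>2"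
  \<comment> \<open>Both bounds hold at every outcome whose estimate lies in
    \<open>K\<close>.\<close>
  proof eventually_elim
    case (elim \<omega>)
    show ?case
      \<comment> \<open>Here \<open>\<mu>\<close> is the common base point \<open>z\<close>, and the
        projection is \<open>y\<close>.\<close>
      using norm_diff_diff_square_le[of "\<mu>h \<omega>" \<mu> "closest_point K \<mu>"]
        closest_point_pythagoras_le[OF \<open>convex K\<close> \<open>closed K\<close> elim, of \<mu>]
      \<comment> \<open>All terms go over the common denominator
        \<open>(sqrt (real CARD('n)))\<^sup>2\<close>, leaving the Euclidean inequalities.\<close>
      unfolding scaled_norm_eq_norm diff_divide_distrib[symmetric] power_divide
      by (simp add: divide_right_mono)
  qed
qed

end
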